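(* Let $Y\sim\Gamma(1,1)$. For all integers $n,m\ge 0$, $$\frac{1}{m+1}\Big(\beta_{m+1,\lambda}^{Y}(n+1)-\beta_{m+1,\lambda}^{Y}\Big)=\sum_{k=0}^{n}\sum_{l=0}^{m}\binom{k+l-1}{l}l!\,\lambda^{m-l}S_{1}(m,l).$$
   Context: $\lambda$ is a fixed nonzero real number. $\Gamma(1,1)$ is the gamma distribution with parameters $\alpha=\beta=1$, i.e. with density $e^{-y}$ for $y\ge0$ and $0$ for $y<0$. For real $x$ and $n\ge1$: $(x)_{n}=x(x-1)\cdots(x-n+1)$, $(x)_{n,\lambda}=x(x-\lambda)\cdots(x-(n-1)\lambda)$, and $(x)_0=(x)_{0,\lambda}=1$. Binomial coefficients are $\binom{a}{l}=\frac{(a)_l}{l!}$ for any integer $a$ and $l\ge0$ (so $\binom{-1}{0}=1$ and $\binom{l-1}{l}=0$ for $l\ge1$). The (signed) Stirling numbers of the first kind $S_1(n,k)$ are defined by the polynomial identity $(x)_n=\sum_{k=0}^nS_1(n,k)x^k$, $n\ge0$. The degenerate exponential is $e_{\lambda}^{x}(t)=(1+\lambda t)^{x/\lambda}=\sum_{n\ge0}(x)_{n,\lambda}\frac{t^n}{n!}$, and $E[e_{\lambda}^{Y}(t)]=\sum_{n\ge0}E[(Y)_{n,\lambda}]\frac{t^n}{n!}$ for $t$ near $0$. The probabilistic degenerate Bernoulli polynomials associated with $Y$ are defined by the power series expansion at $t=0$: $\frac{t}{E[e_{\lambda}^{Y}(t)]-1}\big(E[e_{\lambda}^{Y}(t)]\big)^{x}=\sum_{n\ge0}\beta_{n,\lambda}^{Y}(x)\frac{t^n}{n!}$,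 and $\beta_{n,\lambda}^{Y}=\beta_{n,\lambda}^{Y}(0)$. *)

theory Defs
  imports "HOL-Probability.Probability" "HOL-Computational_Algebra.Polynomial"
begin

definition degen_exp :: "real \<Rightarrow> real \<Rightarrow> real \<Rightarrow> real" where
  "degen_exp lam x t = (1 + lam * t) powr (x / lam)"

definition degen_mgf :: "'a measure \<Rightarrow> ('a \<Rightarrow> real) \<Rightarrow> real \<Rightarrow> real \<Rightarrow> real" where
  "degen_mgf M Y lam t = integral\<^sup>L M (\<lambda>\<omega>. degen_exp lam (Y \<omega>) t)"

(* The coefficient sequence b of the expansion
     t / (E t - 1) * (E t) powr x = (\<Sum>n. b n * t ^ n / fact n),   E = degen_mgf M Y lam,
   about t = 0.  The filter "at 0" excludes t = 0 itself, where the left-hand side has a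
   removable singularity (E 0 = 1).  Such a b is unique whenever it exists. *)
definition degen_bernoulli_poly ::
    "'a measure \<Rightarrow> ('a \<Rightarrow> real) \<Rightarrow> real \<Rightarrow> nat \<Rightarrow> real \<Rightarrow> real" where
  "degen_bernoulli_poly M Y lam n x =
     (THE b :: nat \<Rightarrow> real. \<forall>\<^sub>F t in at 0.
        (\<lambda>k. b k * t ^ k / fact k) sums
          (t / (degen_mgf M Y lam t - 1) * degen_mgf M Y lam t powr x)) n"

definition degen_bernoulli_number ::
    "'a measure \<Rightarrow> ('a \<Rightarrow> real) \<Rightarrow> real \<Rightarrow> nat \<Rightarrow> real" where
  "degen_bernoulli_number M Y lam n = degen_bernoulli_poly M Y lam n 0"

(* Signed Stirling numbers of the first kind: coefficients of x (x - 1) ... (x - n + 1);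
   the library's stirling is the unsigned version. *)
definition S1 :: "nat \<Rightarrow> nat \<Rightarrow> int" where
  "S1 n k = coeff (\<Prod>i<n. [:- int i, 1:]) k"

end

theory Submission
  imports Defs
begin

text \<open>
  Write \<open>L t = ln (1 + lam t) / lam\<close>. The exponential integral gives \<open>E t = 1 / (1 - L t)\<close> near
  \<open>t = 0\<close>, and the geometric sum turns the difference of the two generating functions into
  \<open>t / (E t - 1) * (E t ^ (n + 1) - 1) = t * (\<Sum>k\<le>n. E t ^ k)\<close>. Hence only the Taylor
  coefficients of \<open>E ^ k = (1 - L) powr (- k) = (\<Sum>l. (k + l - 1 choose l) * L ^ l)\<close> are needed,
  and \<open>L ^ l / fact l\<close> is the exponential generating function (in \<open>m\<close>) of \<open>lam ^ (m - l) * S1 m l\<close>.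
\<close>

section \<open>Uniqueness of the expansion\<close>

text \<open>Once the coefficients below \<open>n\<close> are known to vanish, dividing by
  \<open>t ^ n\<close> leaves a series with sum 0 whose limit at 0 is \<open>a n\<close>. A
  punctured neighbourhood suffices, which matches the filter in the definition of
  \<open>degen_bernoulli_poly\<close>.\<close>

lemma powser_sums_zero_imp_coeff_zero:
  fixes a :: "nat \<Rightarrow> 'a::{real_normed_field,banach}"
  assumes "\<forall>\<^sub>F t in at 0. (\<lambda>k. a k * t ^ k) sums 0"
  shows "a n = 0"
proof -
  obtain s where s: "s > 0" "\<And>t. t \<noteq> 0 \<Longrightarrow> norm t < s \<Longrightarrow> (\<lambda>k. a k * t ^ k) sums 0"
    using assms by (auto simp: eventually_at dist_norm)
  show ?thesis
  proof (induction n rule: less_induct)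
    case (less n)
    have "((\<lambda>_. 0) \<longlongrightarrow> a (0 + n)) (at (0::'a))"
    proof (rule powser_limit_0_strong[OF s(1)])
      fix t :: 'a assume t: "t \<noteq> 0" "norm t < s"
      have "(\<lambda>k. a (k + n) * t ^ (k + n)) sums (0 - (\<Sum>k<n. a k * t ^ k))"
        by (rule sums_split_initial_segment[OF s(2)[OF t]])
      then have "(\<lambda>k. (a (k + n) * t ^ (k + n)) * inverse (t ^ n)) sums (0 * inverse (t ^ n))"
        using less by (intro sums_mult2) simp
      then show "(\<lambda>k. a (k + n) * t ^ k) sums 0"
        using t by (simp add: power_add field_simps)
    qed
    then show ?case
      by (simp add: tendsto_const_iff)
  qed
qed

lemma has_fps_expansion_imp_sums:
  fixes F :: "'a::{banach,real_normed_div_algebra} fps"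
  assumes "f has_fps_expansion F"
  shows "\<forall>\<^sub>F t in nhds 0. (\<lambda>n. fps_nth F n * t ^ n) sums f t"
proof -
  have "\<forall>\<^sub>F t in nhds 0. t \<in> eball 0 (fps_conv_radius F)"
    using assms by (intro eventually_nhds_in_open) (auto simp: has_fps_expansion_def zero_ereal_def)
  moreover have "\<forall>\<^sub>F t in nhds 0. eval_fps F t = f t"
    using assms by (simp add: has_fps_expansion_def)
  ultimately show ?thesis
  proof eventually_elim
    case (elim t)
    then show ?case using sums_eval_fps[of t F] by simp
  qed
qed

text \<open>Resolves the definite description: the expansion of \<open>f\<close> gives existence,
  vanishing of the difference coefficients gives uniqueness. At 0 itself \<open>f\<close> may take
  the value that fills the removable singularity.\<close>

lemma degen_bernoulli_poly_eqI:
  assumes F: "f has_fps_expansion F"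
    and f: "\<forall>\<^sub>F t in at 0. f t = t / (degen_mgf M Y lam t - 1) * degen_mgf M Y lam t powr x"
  shows "degen_bernoulli_poly M Y lam n x = fact n * fps_nth F n"
proof -
  let ?g = "\<lambda>t. t / (degen_mgf M Y lam t - 1) * degen_mgf M Y lam t powr x"
  let ?b = "\<lambda>n. fact n * fps_nth F n"
  have ex: "\<forall>\<^sub>F t in at 0. (\<lambda>k. ?b k * t ^ k / fact k) sums ?g t"
  proof -
    have "\<forall>\<^sub>F t in at 0. (\<lambda>k. fps_nth F k * t ^ k) sums f t"
      using has_fps_expansion_imp_sums[OF F] unfolding eventually_at_filter
      by (rule eventually_mono) simp
    then show ?thesis
      using f by eventually_elim simp
  qed
  have "(THE b. \<forall>\<^sub>F t in at 0. (\<lambda>k. b k * t ^ k / fact k) sums ?g t) = ?b"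
  proof (rule the_equality[where P = "\<lambda>b. \<forall>\<^sub>F t in at 0. (\<lambda>k. b k * t ^ k / fact k) sums ?g t", OF ex])
    fix b :: "nat \<Rightarrow> real"
    assume "\<forall>\<^sub>F t in at 0. (\<lambda>k. b k * t ^ k / fact k) sums ?g t"
    with ex have "\<forall>\<^sub>F t in at 0. (\<lambda>k. (b k / fact k - fps_nth F k) * t ^ k) sums 0"
    proof eventually_elim
      case (elim t)
      from sums_diff[OF elim(2,1)] show ?case by (simp add: algebra_simps)
    qed
    from powser_sums_zero_imp_coeff_zero[OF this] show "b = ?b"
      by (auto simp: fun_eq_iff field_simps)
  qed
  then show ?thesis
    by (simp add: degen_bernoulli_poly_def)
qed

section \<open>The degenerate logarithm\<close>

text \<open>Taylor series of \<open>ln (1 + lam * t) / lam\<close>. At \<open>n = 0\<close> division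
  by zero yields the required constant term 0.\<close>

definition fps_degen_ln :: "real \<Rightarrow> real fps" where
  "fps_degen_ln lam = Abs_fps (\<lambda>n. - ((- lam) ^ n) / (lam * real n))"

lemma has_fps_expansion_degen_ln:
  assumes "lam \<noteq> 0"
  shows "(\<lambda>t. ln (1 + lam * t) / lam) has_fps_expansion fps_degen_ln lam"
proof (rule has_fps_expansionI)
  have "\<forall>\<^sub>F t in nhds 0. t \<in> ball 0 (1 / \<bar>lam\<bar>)"
    using assms by (intro eventually_nhds_in_open) auto
  then show "\<forall>\<^sub>F t in nhds 0. (\<lambda>n. fps_nth (fps_degen_ln lam) n * t ^ n) sums (ln (1 + lam * t) / lam)"
  proof eventually_elim
    case (elim t)
    with assms have "\<bar>lam * t\<bar> < 1"
      by (simp add: abs_mult field_simps)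
    from sums_divide[OF ln_series'[OF this], of lam] show ?case
      using power_mult_distrib[of "-lam" t] by (simp add: fps_degen_ln_def mult_ac)
  qed
qed

lemma fps_degen_ln_nth_0 [simp]: "fps_nth (fps_degen_ln lam) 0 = 0"
  by (simp add: fps_degen_ln_def)

lemma fps_degen_ln_nth_1: "lam \<noteq> 0 \<Longrightarrow> fps_nth (fps_degen_ln lam) (Suc 0) = 1"
  by (simp add: fps_degen_ln_def)

text \<open>Formal counterpart of \<open>L' = 1 / (1 + lam * t)\<close>; clearing the denominator
  turns it into a recurrence on coefficients.\<close>

lemma fps_deriv_degen_ln:
  assumes "lam \<noteq> 0"
  shows "(1 + fps_const lam * fps_X) * fps_deriv (fps_degen_ln lam) = 1"
proof (rule fps_ext)
  fix n
  show "fps_nth ((1 + fps_const lam * fps_X) * fps_deriv (fps_degen_ln lam)) n = fps_nth 1 n"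
    using assms
    by (cases n) (simp_all add: distrib_right mult.assoc fps_degen_ln_def del: of_nat_Suc)
qed

section \<open>Stirling numbers of the first kind and powers of the degenerate logarithm\<close>

lemma S1_0_right: "S1 m 0 = (if m = 0 then 1 else 0)"
  by (cases m) (auto simp: S1_def coeff_0_power poly_0_coeff_0[symmetric] poly_prod prod.lessThan_Suc_shift)

lemma S1_0_left: "S1 0 l = (if l = 0 then 1 else 0)"
  by (simp add: S1_def)

lemma S1_Suc_Suc: "S1 (Suc m) (Suc l) = S1 m l - int m * S1 m (Suc l)"
  by (simp add: S1_def mult.commute[of "prod _ _"])

lemma S1_eq_0: "m < l \<Longrightarrow> S1 m l = 0"
  by (induction m arbitrary: l; case_tac l) (auto simp: S1_0_left S1_Suc_Suc)

text \<open>Both sides satisfy the recurrence obtained from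
  \<open>(1 + lam * X) * deriv (L ^ (l + 1)) = (l + 1) * L ^ l\<close>.\<close>

lemma fps_degen_ln_power_nth:
  assumes "lam \<noteq> 0"
  shows "fact m * fps_nth (fps_degen_ln lam ^ l) m = fact l * lam ^ (m - l) * real_of_int (S1 m l)"
proof (induction m arbitrary: l)
  case 0
  then show ?case by (simp add: S1_0_left fps_power_zeroth)
next
  case (Suc m)
  show ?case
  proof (cases l)
    case 0
    then show ?thesis by (simp add: S1_0_right)
  next
    case (Suc l')
    let ?L = "fps_degen_ln lam"
    have "(1 + fps_const lam * fps_X) * fps_deriv (?L ^ Suc l')
        = fps_const (real (Suc l')) * ?L ^ l' * ((1 + fps_const lam * fps_X) * fps_deriv ?L)"
      by (simp add: fps_deriv_power mult_ac del: of_nat_Suc power_Suc)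
    then have "(1 + fps_const lam * fps_X) * fps_deriv (?L ^ Suc l') = fps_const (real (Suc l')) * ?L ^ l'"
      using fps_deriv_degen_ln[OF assms] by simp
    from arg_cong[OF this, of "\<lambda>F. fps_nth F m"]
    have rec: "real (Suc m) * fps_nth (?L ^ Suc l') (Suc m) + lam * real m * fps_nth (?L ^ Suc l') m
        = real (Suc l') * fps_nth (?L ^ l') m"
      by (cases m) (simp_all add: distrib_right mult.assoc del: of_nat_Suc power_Suc)
    have "fact (Suc m) * fps_nth (?L ^ Suc l') (Suc m)
        = fact m * (real (Suc m) * fps_nth (?L ^ Suc l') (Suc m))"
      by (simp add: mult_ac del: power_Suc)
    also have "\<dots> = real (Suc l') * (fact m * fps_nth (?L ^ l') m)
        - lam * real m * (fact m * fps_nth (?L ^ Suc l') m)"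
      unfolding rec[THEN eq_diff_eq[THEN iffD2]] by (simp add: algebra_simps del: power_Suc)
    also have "\<dots> = fact (Suc l') * (lam ^ (m - l') * real_of_int (S1 m l')
        - real m * (lam * lam ^ (m - Suc l') * real_of_int (S1 m (Suc l'))))"
      unfolding Suc.IH by (simp add: algebra_simps)
    \<comment> \<open>Truncated subtraction breaks the exponent law when \<open>m < Suc l'\<close>,
      but then \<open>S1 m (Suc l')\<close> vanishes.\<close>
    also have "lam * lam ^ (m - Suc l') * real_of_int (S1 m (Suc l'))
        = lam ^ (m - l') * real_of_int (S1 m (Suc l'))"
    proof (cases "Suc l' \<le> m")
      case True
      then have "m - l' = Suc (m - Suc l')" by simp
      then show ?thesis by simp
    qed (simp add: S1_eq_0)
    finally show ?thesis
      by (simp add: Suc S1_Suc_Suc algebra_simps del: power_Suc)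
  qed
qed

text \<open>The binomial series of \<open>(1 + X)\<close> to the power \<open>- k\<close>, composed
  with \<open>- F\<close>, which has no constant term. Upper negation of the binomial coefficients
  absorbs the signs.\<close>

lemma fps_one_minus_inverse_power_nth:
  fixes F :: "'a::field_char_0 fps"
  assumes "fps_nth F 0 = 0"
  shows "fps_nth (inverse (1 - F) ^ k) m
    = (\<Sum>l=0..m. ((of_nat k + of_nat l - 1) gchoose l) * fps_nth (F ^ l) m)"
proof -
  have "inverse (1 - F) ^ k = inverse ((1 + fps_X) ^ k) oo (- F)"
    using assms
    by (simp add: fps_inverse_compose fps_compose_power[symmetric] fps_compose_add_distrib
        fps_inverse_power)
  also have "inverse ((1 + fps_X) ^ k) = fps_binomial (- of_nat k :: 'a)"
    by (rule fps_binomial_minus_of_nat[symmetric])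
  finally have "fps_nth (inverse (1 - F) ^ k) m
      = (\<Sum>l=0..m. ((- of_nat k) gchoose l) * fps_nth ((- F) ^ l) m)"
    by (simp add: fps_compose_nth)
  also have "\<dots> = (\<Sum>l=0..m. ((of_nat k + of_nat l - 1) gchoose l) * fps_nth (F ^ l) m)"
  proof (rule sum.cong[OF refl])
    fix l
    have "(- F) ^ l = fps_const ((- 1) ^ l) * F ^ l"
      by (subst power_minus) (simp flip: fps_const_power fps_const_neg)
    then show "((- of_nat k) gchoose l) * fps_nth ((- F) ^ l) m
        = ((of_nat k + of_nat l - 1) gchoose l) * fps_nth (F ^ l) m"
      by (simp add: gbinomial_minus power_mult_distrib[symmetric])
  qed
  finally show ?thesis .
qed

section \<open>The expectation and its powers\<close>

text \<open>Exponential tilting: up to the factor \<open>l / (l - s)\<close> the integrand is the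
  exponential density of rate \<open>l - s\<close>, whose integral is 1.\<close>

lemma integral_exponential_density_exp:
  assumes "s < l" "0 < l"
  shows "(\<integral>y. exponential_density l y * exp (s * y) \<partial>lborel) = l / (l - s)"
proof -
  interpret prob_space "density lborel (exponential_density (l - s))"
    using assms by (intro prob_space_exponential_density) simp
  have "(\<integral>y. exponential_density (l - s) y * 1 \<partial>lborel) = 1"
    using assms prob_space
    by (subst integral_real_density[symmetric]) (auto intro!: exponential_density_nonneg)
  moreover have "exp (- y * (l - s)) = exp (- y * l) * exp (s * y)" for y
    by (simp add: algebra_simps flip: exp_add)
  then have "exponential_density l y * exp (s * y)
      = l / (l - s) * (exponential_density (l - s) y * 1)" for y
    using assms by (simp add: exponential_density_def)
  ultimately show ?thesis
    by (simp only: Bochner_Integration.integral_mult_right_zero)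
qed

text \<open>For \<open>1 + lam * t > 0\<close> the degenerate exponential is
  \<open>exp (?L * Y)\<close>, so this is the ordinary moment generating function of the exponential
  law of rate 1 at \<open>?L\<close>.\<close>

lemma degen_mgf_exponential:
  assumes "distributed M lborel Y (\<lambda>y. ennreal (if y < 0 then 0 else exp (- y)))"
    and "1 + lam * t > 0" "ln (1 + lam * t) / lam < 1"
  shows "degen_mgf M Y lam t = inverse (1 - ln (1 + lam * t) / lam)"
proof -
  let ?L = "ln (1 + lam * t) / lam"
  have dens: "(if y < 0 then 0 else exp (- y)) = exponential_density 1 y" for y :: real
    by (simp add: exponential_density_def)
  have D: "distributed M lborel Y (\<lambda>y. ennreal (exponential_density 1 y))"
    using assms(1) unfolding dens .
  have "degen_mgf M Y lam t = (\<integral>\<omega>. exp (?L * Y \<omega>) \<partial>M)"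
    using assms(2) by (simp add: degen_mgf_def degen_exp_def powr_def mult_ac)
  also have "\<dots> = (\<integral>y. exponential_density 1 y * exp (?L * y) \<partial>lborel)"
    by (rule distributed_integral[OF D, symmetric]) auto
  also have "\<dots> = inverse (1 - ?L)"
    using integral_exponential_density_exp[OF assms(3)] by (simp add: inverse_eq_divide)
  finally show ?thesis .
qed

lemma has_fps_expansion_power':
  fixes F :: "'a::{banach,real_normed_div_algebra,comm_ring_1} fps"
  assumes "f has_fps_expansion F"
  shows "(\<lambda>x. f x ^ k) has_fps_expansion F ^ k"
  using has_fps_expansion_prod[of "{..<k}" "\<lambda>_. f" "\<lambda>_. F"] assms by simp

section \<open>Comparison of the two generating functions\<close>

theorem theorem3p6:
  fixes M :: "'a measure" and Y :: "'a \<Rightarrow> real" and lam :: real and n m :: nat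
  assumes "prob_space M"
    and "distributed M lborel Y (\<lambda>y. ennreal (if y < 0 then 0 else exp (- y)))"
    and "lam \<noteq> 0"
  shows "1 / real (m + 1) *
      (degen_bernoulli_poly M Y lam (m + 1) (real (n + 1)) - degen_bernoulli_number M Y lam (m + 1))
    = (\<Sum>k=0..n. \<Sum>l=0..m.
        ((real k + real l - 1) gchoose l) * fact l * lam ^ (m - l) * real_of_int (S1 m l))"
proof -
  let ?E = "degen_mgf M Y lam"
  define L where "L = (\<lambda>t. ln (1 + lam * t) / lam)"
  define F where "F = fps_degen_ln lam"
  have L: "L has_fps_expansion F"
    unfolding L_def F_def by (rule has_fps_expansion_degen_ln[OF assms(3)])
  have F0: "fps_nth F 0 = 0" and F1: "fps_nth F 1 = 1"
    using assms(3) by (simp_all add: F_def fps_degen_ln_nth_1)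
  then have "F \<noteq> 0" by auto
  have sub: "subdegree F = 1"
    using F0 F1 by (intro subdegreeI) auto

  \<comment> \<open>Since \<open>E - 1 = L / (1 - L)\<close>, this is \<open>t / (E - 1)\<close>
    with the singularity at 0 filled by 1.\<close>
  define f0 where "f0 = (\<lambda>t. if t = 0 then 1 else t * (1 - L t) / L t)"
  define G where "G = fps_X * (1 - F) / F"
  have f0: "f0 has_fps_expansion G"
    unfolding f0_def G_def
  \<comment> \<open>Numerator and denominator both have subdegree 1 with leading coefficient 1, so
    the quotient is a power series with constant term 1.\<close>
  proof (rule has_fps_expansion_divide[OF _ L _ \<open>F \<noteq> 0\<close>])
    show "(\<lambda>t. t * (1 - L t)) has_fps_expansion fps_X * (1 - F)"
      by (intro fps_expansion_intros L)
    have "fps_nth (1 - F) 0 \<noteq> 0" using F0 by simp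
    then have "1 - F \<noteq> 0" by force
    then show "subdegree F \<le> subdegree (fps_X * (1 - F))"
      by (simp add: sub)
    show "1 = fps_nth (fps_X * (1 - F)) (subdegree F) / fps_nth F (subdegree F)"
      using F0 F1 by (simp add: sub)
  qed

  \<comment> \<open>The generating function at \<open>n + 1\<close>, written by the geometric sum so
    that it differs from \<open>f0\<close> by \<open>t\<close> times a sum of powers of
    \<open>E\<close>.\<close>
  define f1 where "f1 = (\<lambda>t. f0 t + t * (\<Sum>k\<le>n. inverse (1 - L t) ^ k))"
  define H where "H = G + fps_X * (\<Sum>k\<le>n. inverse (1 - F) ^ k)"
  have f1: "f1 has_fps_expansion H"
    unfolding f1_def H_def
    by (intro fps_expansion_intros f0 has_fps_expansion_power' L) (simp add: F0)

  have L0: "L 0 = 0" by (simp add: L_def)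
  have "isCont L 0"
    using has_fps_expansion_imp_continuous[OF L] .
  then have "L \<midarrow>0\<rightarrow> 0" by (simp add: isCont_def L0)
  then have "\<forall>\<^sub>F t in at 0. L t < 1"
    by (rule order_tendstoD) simp
  moreover have "((\<lambda>t. 1 + lam * t) \<longlongrightarrow> 1 + lam * 0) (at 0)"
    by (intro tendsto_intros)
  then have "\<forall>\<^sub>F t in at 0. 1 + lam * t > 0"
    by (rule order_tendstoD) simp
  \<comment> \<open>\<open>L t \<noteq> 0\<close> means \<open>E t \<noteq> 1\<close>, as needed for
    the quotient and the geometric sum; \<open>L t < 1\<close> makes \<open>E t\<close> positive, so
    \<open>powr\<close> becomes a natural power.\<close>
  ultimately have ev: "\<forall>\<^sub>F t in at 0. t \<noteq> 0 \<and> ?E t = inverse (1 - L t) \<and> L t < 1 \<and> L t \<noteq> 0"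
    using eventually_neq_at_within[of 0]
  proof eventually_elim
    case (elim t)
    then show ?case
      using degen_mgf_exponential[OF assms(2) elim(2)] assms(3) by (auto simp: L_def)
  qed

  have geom: "t / (x - 1) + t * (\<Sum>k<Suc n. x ^ k) = t / (x - 1) * x ^ (n + 1)"
    if "x \<noteq> 1" for t x :: real
    unfolding geometric_sum[OF that] by (simp add: add_divide_distrib[symmetric] algebra_simps)
  have base: "t / (inverse (1 - u) - 1) = t * (1 - u) / u" if "u < 1" "u \<noteq> 0" for t u :: real
    using that by (simp add: field_simps)
  have B0: "degen_bernoulli_poly M Y lam k 0 = fact k * fps_nth G k" for k
  proof (rule degen_bernoulli_poly_eqI[OF f0])
    show "\<forall>\<^sub>F t in at 0. f0 t = t / (?E t - 1) * ?E t powr 0"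
      using ev
    proof eventually_elim
      case (elim t)
      then show ?case by (simp add: f0_def base)
    qed
  qed
  have B1: "degen_bernoulli_poly M Y lam k (real (n + 1)) = fact k * fps_nth H k" for k
  proof (rule degen_bernoulli_poly_eqI[OF f1])
    show "\<forall>\<^sub>F t in at 0. f1 t = t / (?E t - 1) * ?E t powr real (n + 1)"
      using ev
    proof eventually_elim
      case (elim t)
      let ?e = "inverse (1 - L t)"
      have e: "?e > 0" "?e \<noteq> 1" using elim by (auto simp: field_simps)
      have "f1 t = t / (?e - 1) + t * (\<Sum>k<Suc n. ?e ^ k)"
        using elim by (simp add: f1_def f0_def base lessThan_Suc_atMost)
      also have "\<dots> = t / (?e - 1) * ?e ^ (n + 1)"
        by (rule geom[OF e(2)])
      finally show ?case
        using elim e(1) by (simp only: powr_realpow)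
    qed
  qed

  \<comment> \<open>The series \<open>G\<close> cancels; the factor \<open>fps_X\<close> shifts the
    index from \<open>m + 1\<close> to \<open>m\<close>, and \<open>fact (m + 1) / (m + 1)\<close>
    is \<open>fact m\<close>.\<close>
  have "1 / real (m + 1) *
      (degen_bernoulli_poly M Y lam (m + 1) (real (n + 1)) - degen_bernoulli_number M Y lam (m + 1))
    = fact m * fps_nth (\<Sum>k\<le>n. inverse (1 - F) ^ k) m"
    unfolding degen_bernoulli_number_def B0 B1
    by (simp add: H_def field_simps del: of_nat_Suc)
  also have "\<dots> = (\<Sum>k=0..n. \<Sum>l=0..m.
      ((real k + real l - 1) gchoose l) * (fact m * fps_nth (F ^ l) m))"
    by (simp add: fps_sum_nth fps_one_minus_inverse_power_nth[OF F0] sum_distrib_left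
        atLeast0AtMost mult_ac)
  finally show ?thesis
    unfolding F_def fps_degen_ln_power_nth[OF assms(3)] by (simp add: mult.assoc)
qed

end
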